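(* Let $G=\mathbb{R}^4$ with the Lorentz metric $ds^2=dx_0^2+2e^{x_1}dx_0\,dx_2+\frac{e^{2x_1}}{2}dx_2^2-dx_1^2-dx_3^2$, and let $G_0=\{x_3=0\}$. An isotropic geodesic in $(G,ds^2)$ starting at the unit $(0,0,0,0)$ of $G$ (at $t=0$) and not lying in the subgroup $G_0$, future-directed and with the normalized parametrization described in the context, can have one of two forms: (i) $x_0(t)=x_3(t)=t,\quad x_1(t)=x_2(t)\equiv0,\quad t\in\mathbb{R}$; (ii) $\gamma(t)=(\tilde\gamma(t),\varphi_3t)$, $0<|\varphi_3|<1$, $t\in\mathbb{R}$, where $\varphi_3t$ is the $x_3$-coordinate and $\tilde\gamma(t)=(x_0(t),x_1(t),x_2(t))$ is given, for some $t_0\in\mathbb{R}$, with $$\alpha=\frac{\sqrt2-\sqrt{1-\varphi_3^2}}{\sqrt2+\sqrt{1-\varphi_3^2}},\qquad \omega=\sqrt{\varphi_3^2+1},$$ by $$x_0(t)=-t+2\sqrt2\arctan\left(\sqrt{\alpha}\tan\left(\tfrac{\omega(t-t_0)}{2}\right)\right)-2\sqrt2\arctan\left(\sqrt{\alpha}\tan\left(\tfrac{-\omega t_0}{2}\right)\right),$$ $$x_1(t)=\ln\big((1+\alpha)+(1-\alpha)\cos\tau\big)\Big|_{\tau=-\omega t_0}^{\tau=\omega(t-t_0)},$$ $$x_2(t)=\frac{\beta\sin\tau}{(1+\alpha)+(1-\alpha)\cos\tau}\Big|_{\tau=-\omega t_0}^{\tau=\omega(t-t_0)},\qquad \beta=\frac{\sqrt{2(1-\varphi_3^2)}}{\sqrt{\varphi_3^2+1}}\big[(1+\alpha)+(1-\alpha)\cos(\omega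 t_0)\big].$$
   Context: $G$ is a Lie group on $\mathbb{R}^4$ with coordinates $(x_0,x_1,x_2,x_3)$, unit $0$, and left translations $(x_0',x_1',x_2',x_3')\mapsto(x_0'+p,\;x_1'+q,\;x_2'e^{-q}+c,\;x_3'+d)$ by the element $(p,q,c,d)$; $ds^2$ (signature $(+,-,-,-)$) is left-invariant. Isotropic means null: $ds^2(\gamma',\gamma')=0$, $\gamma'\neq0$. The left-invariant fields $e_0=\partial_{x_0}$, $e_1=\partial_{x_1}$, $e_2'=\sqrt2(\partial_{x_0}-e^{-x_1}\partial_{x_2})$, $e_3=\partial_{x_3}$ form an orthonormal frame. Along a geodesic the $e_0$-component of $\gamma'$ in this frame, $\varphi_0=x_0'+e^{x_1}x_2'$, is constant; future-directed means $\varphi_0>0$, and the normalized parametrization of an isotropic geodesic is the affine parametrization with $\varphi_0=1$. Convention: for a constant $\kappa>0$, the expression $\arctan(\kappa\tan s)$, $s\in\mathbb{R}$, denotes the continuous function of $s$ on $\mathbb{R}$ equal to the principal value on $(-\pi/2,\pi/2)$; i.e. it equals the principal arctangent of $\kappa\tan s$ plus $k\pi$ for $|s-k\pi|<\pi/2$, and equals $\pi/2+k\pi$ at $s=\pi/2+k\pi$, $k\in\mathbb{Z}$. The notation $F(\tau)|_{\tau=A}^{\tau=B}$ means $F(B)-F(A)$.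
   Formalization: Form (i) is corrected to x_0(t)=t, x_3(t)=t or x_3(t)=-t (x_1=x_2=0), since (t,0,0,-t) is also a normalized future-directed isotropic geodesic from the unit not lying in G_0 and is of neither listed form. *)

theory Defs
  imports "HOL-Analysis.Analysis"
begin

section \<open>Geodesics of a metric given in global coordinates\<close>

text \<open>A metric on \<open>\<real>\<^sup>n\<close> is a field \<open>g\<close> of bilinear forms: \<open>g x u v\<close> is the product of the
  tangent vectors \<open>u\<close> and \<open>v\<close> at \<open>x\<close>. No definiteness is required.\<close>

type_synonym 'n metric = "real ^ 'n \<Rightarrow> real ^ 'n \<Rightarrow> real ^ 'n \<Rightarrow> real"

definition metric_matrix :: "'n::finite metric \<Rightarrow> real ^ 'n \<Rightarrow> real ^ 'n ^ 'n" where
  "metric_matrix g x = (\<chi> i j. g x (axis i 1) (axis j 1))"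

definition partial_deriv :: "'n::finite \<Rightarrow> (real ^ 'n \<Rightarrow> real) \<Rightarrow> real ^ 'n \<Rightarrow> real" where
  "partial_deriv i f x = deriv (\<lambda>s. f (x + s *\<^sub>R axis i 1)) 0"

definition christoffel :: "'n::finite metric \<Rightarrow> 'n \<Rightarrow> 'n \<Rightarrow> 'n \<Rightarrow> real ^ 'n \<Rightarrow> real" where
  "christoffel g k i j x =
     (\<Sum>l\<in>UNIV. matrix_inv (metric_matrix g x) $ k $ l *
        (partial_deriv i (\<lambda>y. metric_matrix g y $ j $ l) x
         + partial_deriv j (\<lambda>y. metric_matrix g y $ i $ l) x
         - partial_deriv l (\<lambda>y. metric_matrix g y $ i $ j) x)) / 2"

text \<open>Affinely parametrized geodesics of the Levi-Civita connection; meant for open \<open>I\<close>.\<close>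

definition geodesic_on :: "'n::finite metric \<Rightarrow> real set \<Rightarrow> (real \<Rightarrow> real ^ 'n) \<Rightarrow> bool" where
  "geodesic_on g I \<gamma> \<longleftrightarrow>
     (\<exists>v a. \<forall>t\<in>I. (\<gamma> has_vector_derivative v t) (at t) \<and> (v has_vector_derivative a t) (at t) \<and>
        (\<forall>k. a t $ k
             + (\<Sum>i\<in>UNIV. \<Sum>j\<in>UNIV. christoffel g k i j (\<gamma> t) * v t $ i * v t $ j) = 0))"

abbreviation velocity :: "(real \<Rightarrow> real ^ 'n) \<Rightarrow> real \<Rightarrow> real ^ 'n::finite" where
  "velocity \<gamma> t \<equiv> vector_derivative \<gamma> (at t)"

definition isotropic_on :: "'n::finite metric \<Rightarrow> real set \<Rightarrow> (real \<Rightarrow> real ^ 'n) \<Rightarrow> bool" where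
  "isotropic_on g I \<gamma> \<longleftrightarrow>
     (\<forall>t\<in>I. g (\<gamma> t) (velocity \<gamma> t) (velocity \<gamma> t) = 0 \<and> velocity \<gamma> t \<noteq> 0)"


section \<open>The Goedel metric\<close>

text \<open>The index type \<open>4\<close> has the elements \<open>0, 1, 2, 3\<close>, so that \<open>x $ i\<close> is the coordinate
  \<open>x\<^sub>i\<close> (and \<open>(4::4) = 0\<close>). The form is the polarization of \<open>ds\<^sup>2\<close>, and the unit of the
  group is \<open>0\<close>.\<close>

definition godel :: "4 metric" where
  "godel x u v =
     u $ 0 * v $ 0 + exp (x $ 1) * (u $ 0 * v $ 2 + u $ 2 * v $ 0)
     + exp (2 * x $ 1) / 2 * (u $ 2 * v $ 2) - u $ 1 * v $ 1 - u $ 3 * v $ 3"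

lemma godel_quadratic:
  "godel x v v = (v $ 0)\<^sup>2 + 2 * exp (x $ 1) * v $ 0 * v $ 2 + exp (2 * x $ 1) / 2 * (v $ 2)\<^sup>2
                 - (v $ 1)\<^sup>2 - (v $ 3)\<^sup>2"
  by (simp add: godel_def power2_eq_square algebra_simps)

definition G0 :: "(real ^ 4) set" where
  "G0 = {x. x $ 3 = 0}"

definition godel_frame :: "real ^ 4 \<Rightarrow> 4 \<Rightarrow> real ^ 4" where
  "godel_frame x i =
     (if i = 2 then sqrt 2 *\<^sub>R (axis 0 1 - exp (- x $ 1) *\<^sub>R axis 2 1) else axis i 1)"

definition phi0 :: "real ^ 4 \<Rightarrow> real ^ 4 \<Rightarrow> real" where
  "phi0 x v = v $ 0 + exp (x $ 1) * v $ 2"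

text \<open>\<open>phi0 x v\<close> is the \<open>e\<^sub>0\<close>-component of \<open>v\<close> in the left-invariant orthonormal frame.\<close>

lemma godel_frame_orthonormal:
  "godel x (godel_frame x i) (godel_frame x j) = (if i = j then if i = 0 then 1 else - 1 else 0)"
proof -
  have e: "exp (2 * x $ 1) = exp (x $ 1) * exp (x $ 1)"
    by (simp add: mult_exp_exp)
  have "\<forall>i j::4. godel x (godel_frame x i) (godel_frame x j)
          = (if i = j then if i = 0 then 1 else - 1 else 0)"
    unfolding forall_4
    by (simp add: godel_def godel_frame_def axis_def exp_minus e) (simp add: field_simps)
  then show ?thesis by blast
qed

lemma num4_eq_0: "(4::4) = 0"
  by simp

lemma godel_frame_decomposition:
  "v = phi0 x v *\<^sub>R godel_frame x 0 + v $ 1 *\<^sub>R godel_frame x 1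
       + (- exp (x $ 1) * v $ 2 / sqrt 2) *\<^sub>R godel_frame x 2 + v $ 3 *\<^sub>R godel_frame x 3"
  unfolding vec_eq_iff forall_4 num4_eq_0
  by (simp add: phi0_def godel_frame_def axis_def exp_minus field_simps)


section \<open>The constants and functions in the parametrization\<close>

text \<open>The continuous branch of \<open>arctan (\<kappa> * tan s)\<close>: the integer \<open>round (s / pi)\<close> is the \<open>k\<close>
  with \<open>\<bar>s - k * pi\<bar> < pi / 2\<close> when \<open>cos s \<noteq> 0\<close>, and \<open>cos s = 0\<close> means
  \<open>s = pi / 2 + k * pi\<close>, where the value is \<open>pi / 2 + k * pi\<close> again.\<close>

definition arctan_tan :: "real \<Rightarrow> real \<Rightarrow> real" where
  "arctan_tan \<kappa> s =
     (if cos s = 0 then s else arctan (\<kappa> * tan s) + of_int (round (s / pi)) * pi)"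

definition alpha :: "real \<Rightarrow> real" where
  "alpha \<phi>3 = (sqrt 2 - sqrt (1 - \<phi>3\<^sup>2)) / (sqrt 2 + sqrt (1 - \<phi>3\<^sup>2))"

definition omega :: "real \<Rightarrow> real" where
  "omega \<phi>3 = sqrt (\<phi>3\<^sup>2 + 1)"

definition denom :: "real \<Rightarrow> real \<Rightarrow> real" where
  "denom \<phi>3 \<tau> = (1 + alpha \<phi>3) + (1 - alpha \<phi>3) * cos \<tau>"

definition beta :: "real \<Rightarrow> real \<Rightarrow> real" where
  "beta \<phi>3 t0 = sqrt (2 * (1 - \<phi>3\<^sup>2)) / sqrt (\<phi>3\<^sup>2 + 1) * denom \<phi>3 (omega \<phi>3 * t0)"

definition curve_i :: "real \<Rightarrow> (real \<Rightarrow> real ^ 4) \<Rightarrow> bool" where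
  "curve_i \<sigma> c \<longleftrightarrow> (\<forall>t. c t $ 0 = t \<and> c t $ 1 = 0 \<and> c t $ 2 = 0 \<and> c t $ 3 = \<sigma> * t)"

definition curve_ii :: "real \<Rightarrow> real \<Rightarrow> (real \<Rightarrow> real ^ 4) \<Rightarrow> bool" where
  "curve_ii \<phi>3 t0 c \<longleftrightarrow> (\<forall>t.
     c t $ 0 = - t + 2 * sqrt 2 * arctan_tan (sqrt (alpha \<phi>3)) (omega \<phi>3 * (t - t0) / 2)
                   - 2 * sqrt 2 * arctan_tan (sqrt (alpha \<phi>3)) (- omega \<phi>3 * t0 / 2) \<and>
     c t $ 1 = ln (denom \<phi>3 (omega \<phi>3 * (t - t0))) - ln (denom \<phi>3 (- omega \<phi>3 * t0)) \<and>
     c t $ 2 = beta \<phi>3 t0 * sin (omega \<phi>3 * (t - t0)) / denom \<phi>3 (omega \<phi>3 * (t - t0))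
               - beta \<phi>3 t0 * sin (- omega \<phi>3 * t0) / denom \<phi>3 (- omega \<phi>3 * t0) \<and>
     c t $ 3 = \<phi>3 * t)"

end

theory Submission
  imports Defs
begin

text \<open>Along a geodesic with \<open>\<phi>\<^sub>0 = 1\<close> the quantities \<open>\<phi>\<^sub>3 = x\<^sub>3'\<close> and
  \<open>C = (2 - e\<^bsup>x\<^sub>1\<^esup> x\<^sub>2') e\<^bsup>x\<^sub>1\<^esup>\<close> are constant. Inserting them into the isotropy condition turns
  the equation for \<open>x\<^sub>1\<close> into the harmonic oscillator \<open>u'' = C - \<omega>\<^sup>2 u\<close> for \<open>u = e\<^bsup>x\<^sub>1\<^esup>\<close>, where
  \<open>\<omega>\<^sup>2 = 1 + \<phi>\<^sub>3\<^sup>2\<close>, and isotropy fixes its relative amplitude: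
  \<open>u = D (1 + \<epsilon> cos (\<omega> (t - t\<^sub>0)))\<close> with \<open>\<epsilon>\<^sup>2 = (1 - \<phi>\<^sub>3\<^sup>2) / 2\<close>, that is
  \<open>\<epsilon> = (1 - \<alpha>) / (1 + \<alpha>)\<close>. Then \<open>x\<^sub>0' = C / u - 1\<close> and \<open>x\<^sub>2' = 2 / u - C / u\<^sup>2\<close> integrate to the
  stated formulas. The case \<open>\<phi>\<^sub>3\<^sup>2 = 1\<close> is the equilibrium \<open>u = 1\<close>.\<close>

section \<open>The geodesic equations of the Goedel metric\<close>

text \<open>\<open>matrix_inv\<close> is a Hilbert choice among two-sided inverses, so evaluating it
  rests on their uniqueness.\<close>

lemma matrix_inv_eqI:
  fixes A B :: "'a::semiring_1 ^ 'n ^ 'n"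
  assumes "A ** B = mat 1" and "B ** A = mat 1"
  shows "matrix_inv A = B"
  unfolding matrix_inv_def
proof (rule some_equality)
  show "B' = B" if "A ** B' = mat 1 \<and> B' ** A = mat 1" for B'
    using assms that by (metis matrix_mul_assoc matrix_mul_lid matrix_mul_rid)
qed (use assms in blast)

lemma metric_matrix_godel:
  "metric_matrix godel x $ i $ j =
     (if i = j then if i = 0 then 1 else if i = 2 then exp (2 * x $ 1) / 2 else - 1
      else if {i, j} = {0, 2} then exp (x $ 1) else 0)"
proof -
  have "\<forall>i j. metric_matrix godel x $ i $ j =
     (if i = j then if i = 0 then 1 else if i = 2 then exp (2 * x $ 1) / 2 else - 1
      else if {i, j} = {0, 2} then exp (x $ 1) else 0)"
    \<comment> \<open>\<open>forall_4\<close> enumerates the indices as 1, 2, 3, 4;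
      \<open>num4_eq_0\<close> turns 4 into 0, the index of the time coordinate.\<close>
    unfolding forall_4 num4_eq_0
    by (simp add: metric_matrix_def godel_def axis_def doubleton_eq_iff)
  then show ?thesis
    by blast
qed

text \<open>With E = \<open>exp (x $ 1)\<close> the matrix is the block with rows (1, E) and (E,
  E^2/2) on the indices 0 and 2, of determinant -E^2/2, together with -1 at the indices 1 and
  3.\<close>

lemma matrix_inv_metric_matrix_godel:
  "matrix_inv (metric_matrix godel x) $ i $ j =
     (if i = j then if i = 2 then - 2 * exp (- 2 * x $ 1) else - 1
      else if {i, j} = {0, 2} then 2 * exp (- x $ 1) else 0)" (is "_ = ?B i j")
proof -
  define E where "E = exp (x $ 1)"
  have E: "E \<noteq> 0" "exp (x $ 1) = E" "exp (- x $ 1) = inverse E"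
    "exp (2 * x $ 1) = E\<^sup>2" "exp (- 2 * x $ 1) = inverse (E\<^sup>2)"
    by (simp_all add: E_def exp_minus exp_double)
  have "matrix_inv (metric_matrix godel x) = (\<chi> i j. ?B i j)"
    unfolding E
    by (rule matrix_inv_eqI; unfold vec_eq_iff forall_4 num4_eq_0;
        simp add: matrix_matrix_mult_def sum_4 metric_matrix_godel mat_def doubleton_eq_iff E(2-))
       (use E(1) in \<open>simp_all add: field_simps power2_eq_square\<close>)
  then show ?thesis
    by simp
qed

lemma partial_deriv_metric_matrix_godel:
  "partial_deriv k (\<lambda>y. metric_matrix godel y $ i $ j) x =
     (if k = 1 then if i = 2 \<and> j = 2 then exp (2 * x $ 1)
        else if {i, j} = {0, 2} then exp (x $ 1) else 0 else 0)"
proof -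
  \<comment> \<open>\<open>e\<close> is the slope of \<open>x $ 1\<close> along direction
    \<open>k\<close>. Only this coordinate enters the metric, so the chain rule with
    \<open>e\<close> treats all four directions at once.\<close>
  define e :: real where "e = (if k = 1 then 1 else 0)"
  have e: "(x + s *\<^sub>R axis k 1) $ 1 = x $ 1 + s * e" for s
    by (simp add: e_def axis_def)
  have d: "((\<lambda>s. exp (2 * (x $ 1 + s * e)) / 2) has_real_derivative e * exp (2 * x $ 1)) (at 0)"
    "((\<lambda>s. exp (x $ 1 + s * e)) has_real_derivative e * exp (x $ 1)) (at 0)"
    by (auto intro!: derivative_eq_intros)
  have "((\<lambda>s. metric_matrix godel (x + s *\<^sub>R axis k 1) $ i $ j) has_field_derivative
     (if i = j then if i = 0 then 0 else if i = 2 then e * exp (2 * x $ 1) else 0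
      else if {i, j} = {0, 2} then e * exp (x $ 1) else 0)) (at 0)"
    unfolding metric_matrix_godel e
    by (cases "i = j"; cases "i = 0"; cases "i = 2"; cases "{i, j} = {0, 2}")
      (use d in simp_all)
  then have "deriv (\<lambda>s. metric_matrix godel (x + s *\<^sub>R axis k 1) $ i $ j) 0 = 
     (if i = j then if i = 0 then 0 else if i = 2 then e * exp (2 * x $ 1) else 0
      else if {i, j} = {0, 2} then e * exp (x $ 1) else 0)"
    by (rule DERIV_imp_deriv)
  then show ?thesis
    by (auto simp: partial_deriv_def e_def)
qed

text \<open>The geodesic equation needs only this contraction, so no table of single Christoffel
  symbols is made. Component 3 vanishes because the metric is a product with a flat line.\<close>

lemma sum_christoffel_godel:
  "(\<Sum>i\<in>UNIV. \<Sum>j\<in>UNIV. christoffel godel k i j x * v $ i * v $ j) =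
     (if k = 0 then 2 * v $ 0 * v $ 1 + exp (x $ 1) * v $ 1 * v $ 2
      else if k = 1 then exp (x $ 1) * v $ 0 * v $ 2 + exp (2 * x $ 1) / 2 * (v $ 2)\<^sup>2
      else if k = 2 then - 2 * exp (- x $ 1) * v $ 0 * v $ 1
      else 0)" (is "?L k = ?R k")
proof -
  define E where "E = exp (x $ 1)"
  have E: "E \<noteq> 0" "exp (x $ 1) = E" "exp (- x $ 1) = inverse E"
    "exp (2 * x $ 1) = E\<^sup>2" "exp (- 2 * x $ 1) = inverse (E\<^sup>2)"
    by (simp_all add: E_def exp_minus exp_double)
  have "\<forall>k. ?L k = ?R k"
    unfolding forall_4 christoffel_def sum_4 matrix_inv_metric_matrix_godel
      partial_deriv_metric_matrix_godel E(2-) num4_eq_0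
    by (simp add: doubleton_eq_iff) (use E(1) in \<open>simp add: field_simps power2_eq_square\<close>)
  then show ?thesis
    by blast
qed

section \<open>The continuous branch of the arctangent\<close>

text \<open>This form shows that the continuous branch is smooth also where \<open>cos s = 0\<close>.\<close>

lemma arctan_tan_eq:
  assumes "0 < \<kappa>"
  shows "arctan_tan \<kappa> s =
    s + arctan ((\<kappa> - 1) * sin s * cos s / ((cos s)\<^sup>2 + \<kappa> * (sin s)\<^sup>2))"
proof (cases "cos s = 0")
  case True
  then show ?thesis
    by (simp add: arctan_tan_def)
next
  case False
  \<comment> \<open>\<open>r\<close> represents \<open>s\<close> modulo \<open>pi\<close> in the
    principal interval, and \<open>arctan_tan\<close> adds exactly the multiple of \<open>pi\<close>
    that separates \<open>s\<close> from \<open>r\<close>; the claim thus reduces to one about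
    \<open>r\<close>.\<close>
  define k where "k = round (s / pi)"
  define r where "r = s - of_int k * pi"
  have "\<bar>of_int k - s / pi\<bar> \<le> 1 / 2"
    unfolding k_def by (rule of_int_round_abs_le)
  then have "\<bar>(of_int k - s / pi) * pi\<bar> \<le> 1 / 2 * pi"
    unfolding abs_mult by (intro mult_mono) auto
  then have r_le: "\<bar>r\<bar> \<le> pi / 2"
    by (simp add: r_def left_diff_distrib abs_minus_commute)
  have s: "s = r + of_int k * pi"
    by (simp add: r_def)
  have k: "sin (of_int k * pi) = 0"
    by (simp add: mult.commute)
  have c1: "(cos (of_int k * pi))\<^sup>2 = 1"
    using sin_cos_squared_add[of "of_int k * pi"] k by simp
  have sc: "cos s = cos r * cos (of_int k * pi)" "sin s = sin r * cos (of_int k * pi)"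
    unfolding s by (simp_all add: cos_add sin_add k)
  have cr: "cos r \<noteq> 0"
    using False sc by auto
  have "r \<noteq> pi / 2" "r \<noteq> - (pi / 2)"
    using cr by (metis cos_pi_half, metis cos_pi_half cos_minus)
  then have r: "- (pi / 2) < r" "r < pi / 2"
    using r_le by linarith+
  have cpos: "0 < cos r"
    using r by (intro cos_gt_zero_pi) auto
  \<comment> \<open>Both parts of the fraction are homogeneous of degree two in sine and cosine, so
    the common sign produced by the shift cancels.\<close>
  have quot: "(\<kappa> - 1) * sin s * cos s / ((cos s)\<^sup>2 + \<kappa> * (sin s)\<^sup>2)
      = (\<kappa> - 1) * sin r * cos r / ((cos r)\<^sup>2 + \<kappa> * (sin r)\<^sup>2)"
  proof -
    have "(\<kappa> - 1) * sin s * cos s = (\<kappa> - 1) * sin r * cos r * (cos (of_int k * pi))\<^sup>2"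
      unfolding sc power2_eq_square by simp
    then show ?thesis
      unfolding sc power_mult_distrib c1 by simp
  qed
  define a where "a = arctan (\<kappa> * tan r)"
  have a: "- (pi / 2) < a" "a < pi / 2" "tan a = \<kappa> * tan r"
    using arctan_bounded by (simp_all add: a_def tan_arctan)
  have ca: "0 < cos a"
    using a by (intro cos_gt_zero_pi) auto
  \<comment> \<open>\<open>a\<close> and \<open>r\<close> lie in the principal interval and, as
    \<kappa> is positive, on the same side of 0. Hence \<open>a - r\<close> can be recovered from
    its tangent.\<close>
  have bnd: "- (pi / 2) < a - r \<and> a - r < pi / 2"
  proof (cases "0 \<le> r")
    case True
    then have "0 \<le> a"
      using r assms by (simp add: a_def tan_pos_pi2_le)
    then show ?thesis
      using True a r by linarith
  next
    case False
    then have "tan r < 0"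
      using r by (intro tan_less_zero) auto
    then have "a < 0"
      using assms by (simp add: a_def mult_pos_neg)
    then show ?thesis
      using False a r by linarith
  qed
  have "cos (a - r) \<noteq> 0"
    using bnd by (intro less_imp_neq[THEN not_sym] cos_gt_zero_pi) auto
  then have "tan (a - r) = (\<kappa> * tan r - tan r) / (1 + \<kappa> * tan r * tan r)"
    using tan_diff[of a r] ca cr a by simp
  also have "\<dots> = (\<kappa> - 1) * sin r * cos r / ((cos r)\<^sup>2 + \<kappa> * (sin r)\<^sup>2)"
  proof -
    have "0 < (cos r)\<^sup>2 + \<kappa> * (sin r)\<^sup>2"
      using cpos assms by (intro add_pos_nonneg) auto
    moreover have "1 + \<kappa> * tan r * tan r = ((cos r)\<^sup>2 + \<kappa> * (sin r)\<^sup>2) / (cos r)\<^sup>2"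
      using cr by (simp add: tan_def field_simps power2_eq_square)
    moreover have "\<kappa> * tan r - tan r = (\<kappa> - 1) * sin r * cos r / (cos r)\<^sup>2"
      using cr by (simp add: tan_def field_simps power2_eq_square)
    ultimately show ?thesis
      using cr by simp
  qed
  finally have "arctan ((\<kappa> - 1) * sin r * cos r / ((cos r)\<^sup>2 + \<kappa> * (sin r)\<^sup>2)) = a - r"
    using bnd by (intro arctan_unique) auto
  moreover have "tan s = tan r"
    unfolding s by simp
  ultimately show ?thesis
    using False unfolding quot by (simp add: arctan_tan_def a_def r_def k_def)
qed

text \<open>Differentiating the form in \<open>arctan_tan_eq\<close> covers the points with
  \<open>cos s = 0\<close> without a separate limit argument.\<close>

lemma has_real_derivative_arctan_tan:
  assumes "0 < \<kappa>"
  shows "(arctan_tan \<kappa> has_real_derivative \<kappa> / ((cos s)\<^sup>2 + \<kappa>\<^sup>2 * (sin s)\<^sup>2)) (at s)"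
proof -
  define q where "q = (cos s)\<^sup>2 + \<kappa> * (sin s)\<^sup>2"
  have pos: "0 < (cos s)\<^sup>2 + l * (sin s)\<^sup>2" if "0 < l" for l
  proof (cases "sin s = 0")
    case True
    then show ?thesis
      using sin_cos_squared_add[of s] by simp
  next
    case False
    then show ?thesis
      using that by (intro add_nonneg_pos) auto
  qed
  have q: "q \<noteq> 0" "(cos s)\<^sup>2 + \<kappa>\<^sup>2 * (sin s)\<^sup>2 \<noteq> 0"
    using pos[of \<kappa>] pos[of "\<kappa>\<^sup>2"] assms by (auto simp: q_def)
  have one: "(sin s)\<^sup>2 = 1 - (cos s)\<^sup>2"
    by (simp add: sin_squared_eq)
  \<comment> \<open>Both sides are the squared modulus of (cos s + i \<kappa> sin s)(cos s - i sin
    s), whose second factor has modulus 1.\<close>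
  have N: "q\<^sup>2 + ((\<kappa> - 1) * sin s * cos s)\<^sup>2 = (cos s)\<^sup>2 + \<kappa>\<^sup>2 * (sin s)\<^sup>2"
    unfolding q_def power_mult_distrib one by (simp add: power2_eq_square algebra_simps)
  \<comment> \<open>\<open>D\<close> is the derivative of the quotient inside
    \<open>arctan\<close>.\<close>
  define D where "D = ((\<kappa> - 1) * ((cos s)\<^sup>2 - (sin s)\<^sup>2) * q -
      (\<kappa> - 1) * sin s * cos s * (2 * (\<kappa> - 1) * sin s * cos s)) / q\<^sup>2"
  have "((\<lambda>s. s + arctan ((\<kappa> - 1) * sin s * cos s / ((cos s)\<^sup>2 + \<kappa> * (sin s)\<^sup>2)))
      has_real_derivative 1 + inverse (1 + ((\<kappa> - 1) * sin s * cos s / q)\<^sup>2) * D) (at s)"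
    unfolding q_def[symmetric]
    by (rule derivative_eq_intros refl)+
      (use q in \<open>auto simp: q_def D_def power2_eq_square algebra_simps\<close>)
  moreover have "1 + inverse (1 + ((\<kappa> - 1) * sin s * cos s / q)\<^sup>2) * D
      = \<kappa> / ((cos s)\<^sup>2 + \<kappa>\<^sup>2 * (sin s)\<^sup>2)"
  proof -
    have "1 + ((\<kappa> - 1) * sin s * cos s / q)\<^sup>2 = ((cos s)\<^sup>2 + \<kappa>\<^sup>2 * (sin s)\<^sup>2) / q\<^sup>2"
      using q by (simp add: N[symmetric] power_divide add_divide_distrib)
    moreover have "D * q\<^sup>2 = \<kappa> - ((cos s)\<^sup>2 + \<kappa>\<^sup>2 * (sin s)\<^sup>2)"
    proof -
      have "D * q\<^sup>2 = (\<kappa> - 1) * ((cos s)\<^sup>2 - (sin s)\<^sup>2) * q -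
        2 * (\<kappa> - 1)\<^sup>2 * (sin s)\<^sup>2 * (cos s)\<^sup>2"
        using q by (simp add: D_def power2_eq_square)
      also have "\<dots> = \<kappa> - ((cos s)\<^sup>2 + \<kappa>\<^sup>2 * (sin s)\<^sup>2)"
        unfolding q_def one by (simp add: power2_eq_square algebra_simps)
      finally show ?thesis .
    qed
    ultimately show ?thesis
      using q by (simp add: field_simps)
  qed
  moreover have "arctan_tan \<kappa> =
      (\<lambda>s. s + arctan ((\<kappa> - 1) * sin s * cos s / ((cos s)\<^sup>2 + \<kappa> * (sin s)\<^sup>2)))"
    by (intro ext arctan_tan_eq assms)
  ultimately show ?thesis
    by simp
qed

section \<open>Reduction to a linear equation\<close>

lemma has_vector_derivative_vec_iff:
  fixes f :: "real \<Rightarrow> real ^ 'n::finite"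
  shows "(f has_vector_derivative f') (at t) \<longleftrightarrow>
    (\<forall>k. ((\<lambda>t. f t $ k) has_real_derivative f' $ k) (at t))"
  unfolding has_vector_derivative_def
  by (subst has_derivative_componentwise_within)
     (auto simp: Basis_vec_def inner_axis has_real_derivative_iff_has_vector_derivative
        has_vector_derivative_def)

text \<open>The tool for all first integrals below: on an interval, local constancy becomes equality
  with the value at time 0.\<close>

lemma DERIV_zero_imp_eq:
  fixes f :: "real \<Rightarrow> real"
  assumes "is_interval I" and "\<And>t. t \<in> I \<Longrightarrow> (f has_real_derivative 0) (at t)"
    and "s \<in> I" and "t \<in> I"
  shows "f s = f t"
proof -
  have "\<exists>c. \<forall>x\<in>I. f x = c"
    using assms(1,2) by (intro has_field_derivative_zero_constant)
      (auto intro: has_field_derivative_at_within simp: is_interval_convex)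
  then show ?thesis
    using assms(3,4) by auto
qed

text \<open>With \<open>u = exp x\<^sub>1\<close> and the first integral \<open>C = (2 - u x\<^sub>2') u\<close>, the geodesic equations for
  \<open>\<phi>\<^sub>0 = 1\<close> become linear in \<open>u\<close>; the quadratic equation below says that the curve is isotropic.\<close>

definition reduced_geodesic ::
    "real \<Rightarrow> real \<Rightarrow> real set \<Rightarrow> (real \<Rightarrow> real) \<Rightarrow> (real \<Rightarrow> real) \<Rightarrow> (real \<Rightarrow> real ^ 4) \<Rightarrow> bool" where
  "reduced_geodesic \<phi> C I u p \<gamma> \<longleftrightarrow> (\<forall>t\<in>I. 0 < u t \<and>
     (u has_real_derivative p t) (at t) \<and>
     (p has_real_derivative C - (1 + \<phi>\<^sup>2) * u t) (at t) \<and>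
     (p t)\<^sup>2 + (2 * u t - C)\<^sup>2 / 2 = (1 - \<phi>\<^sup>2) * (u t)\<^sup>2 \<and>
     ((\<lambda>t. \<gamma> t $ 0) has_real_derivative C / u t - 1) (at t) \<and>
     \<gamma> t $ 1 = ln (u t) \<and>
     ((\<lambda>t. \<gamma> t $ 2) has_real_derivative 2 / u t - C / (u t)\<^sup>2) (at t) \<and>
     \<gamma> t $ 3 = \<phi> * t)"

lemma reduced_geodesicD:
  assumes "reduced_geodesic \<phi> C I u p \<gamma>" and "t \<in> I"
  shows "0 < u t" and "(u has_real_derivative p t) (at t)"
    and "(p has_real_derivative C - (1 + \<phi>\<^sup>2) * u t) (at t)"
    and "(p t)\<^sup>2 + (2 * u t - C)\<^sup>2 / 2 = (1 - \<phi>\<^sup>2) * (u t)\<^sup>2"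
    and "((\<lambda>t. \<gamma> t $ 0) has_real_derivative C / u t - 1) (at t)"
    and "\<gamma> t $ 1 = ln (u t)"
    and "((\<lambda>t. \<gamma> t $ 2) has_real_derivative 2 / u t - C / (u t)\<^sup>2) (at t)"
    and "\<gamma> t $ 3 = \<phi> * t"
  using assms by (auto simp: reduced_geodesic_def)

text \<open>Derivatives are local on an open set. This carries the explicit curves, which solve the
  system on the whole line, over to \<open>I\<close>.\<close>

lemma reduced_geodesic_cong:
  assumes c: "reduced_geodesic \<phi> C UNIV u p c" and "open I" and eq: "\<And>t. t \<in> I \<Longrightarrow> \<gamma> t = c t"
  shows "reduced_geodesic \<phi> C I u p \<gamma>"
proof -
  have "((\<lambda>t. \<gamma> t $ k) has_real_derivative d) (at t)"
    if "((\<lambda>t. c t $ k) has_real_derivative d) (at t)" "t \<in> I" for k d t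
    using that eq by (elim has_field_derivative_transform_within_open[OF _ \<open>open I\<close>]) auto
  then show ?thesis
    using c eq by (auto simp: reduced_geodesic_def)
qed

text \<open>Once \<open>u\<close> is known, components 1 and 3 are explicit, while 0 and 2 are
  quadratures with equal integrands and equal initial values.\<close>

lemma reduced_geodesic_unique:
  assumes \<gamma>: "reduced_geodesic \<phi> C I u p \<gamma>" and c: "reduced_geodesic \<phi> C I u' p' c"
    and u: "\<And>t. t \<in> I \<Longrightarrow> u t = u' t" and "is_interval I" and "0 \<in> I" and "\<gamma> 0 = c 0"
    and "t \<in> I"
  shows "\<gamma> t = c t"
proof -
  have "\<gamma> t $ k = c t $ k" if k: "k = 0 \<or> k = 2" for k
  proof -
    have "((\<lambda>t. \<gamma> t $ k - c t $ k) has_real_derivative 0) (at s)" if "s \<in> I" for s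
      using k
      by (auto intro!: derivative_eq_intros
          reduced_geodesicD(5,7)[OF \<gamma> that] reduced_geodesicD(5,7)[OF c that] simp: u[OF that])
    from DERIV_zero_imp_eq[OF assms(4) this \<open>t \<in> I\<close> \<open>0 \<in> I\<close>] show ?thesis
      using \<open>\<gamma> 0 = c 0\<close> by simp
  qed
  moreover have "\<gamma> t $ k = c t $ k" if "k = 1 \<or> k = 3" for k
    using that reduced_geodesicD(6,8)[OF \<gamma> \<open>t \<in> I\<close>] reduced_geodesicD(6,8)[OF c \<open>t \<in> I\<close>]
      u[OF \<open>t \<in> I\<close>] by auto
  ultimately show ?thesis
    unfolding vec_eq_iff forall_4 num4_eq_0 by blast
qed

text \<open>The quadratic clause serves twice: it eliminates \<open>(p t)\<^sup>2\<close> from the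
  geodesic equation of component 1, and it is the null condition itself.\<close>

lemma reduced_geodesic_imp_isotropic_geodesic:
  assumes r: "reduced_geodesic \<phi> C I u p \<gamma>" and "open I"
  shows "geodesic_on godel I \<gamma>" and "isotropic_on godel I \<gamma>"
    and "\<forall>t\<in>I. phi0 (\<gamma> t) (velocity \<gamma> t) = 1"
proof -
  \<comment> \<open>\<open>v\<close> and \<open>a\<close> are the velocity and acceleration
    expressed through \<open>u\<close>, \<open>p\<close> and the two constants.\<close>
  define v :: "real \<Rightarrow> real ^ 4" where
    "v t = (\<chi> k. if k = 0 then C / u t - 1 else if k = 1 then p t / u t
        else if k = 2 then 2 / u t - C / (u t)\<^sup>2 else \<phi>)" for t
  define a :: "real \<Rightarrow> real ^ 4" where
    "a t = (\<chi> k. if k = 0 then - C * p t / (u t)\<^sup>2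
        else if k = 1 then (C - (1 + \<phi>\<^sup>2) * u t) / u t - (p t)\<^sup>2 / (u t)\<^sup>2
        else if k = 2 then - 2 * p t / (u t)\<^sup>2 + 2 * C * p t / (u t) ^ 3 else 0)" for t
  note D = reduced_geodesicD[OF r]
  have \<gamma>v: "(\<gamma> has_vector_derivative v t) (at t)" if t: "t \<in> I" for t
  proof -
    have "((\<lambda>t. \<gamma> t $ 1) has_real_derivative p t / u t) (at t)"
    proof (rule has_field_derivative_transform_within_open[OF _ \<open>open I\<close> t])
      show "((\<lambda>t. ln (u t)) has_real_derivative p t / u t) (at t)"
        using D(1,2)[OF t] by (auto intro!: derivative_eq_intros simp: field_simps)
    qed (simp add: D(6))
    moreover have "((\<lambda>t. \<gamma> t $ 3) has_real_derivative \<phi>) (at t)"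
    proof (rule has_field_derivative_transform_within_open[OF _ \<open>open I\<close> t])
      show "((\<lambda>t. \<phi> * t) has_real_derivative \<phi>) (at t)"
        by (auto intro!: derivative_eq_intros)
    qed (simp add: D(8))
    ultimately show ?thesis
      unfolding has_vector_derivative_vec_iff forall_4 num4_eq_0 v_def
      using D(5,7)[OF t] by simp
  qed
  have va: "(v has_vector_derivative a t) (at t)" if t: "t \<in> I" for t
    unfolding has_vector_derivative_vec_iff forall_4 num4_eq_0 v_def a_def
    using D(1)[OF t]
    by (auto intro!: derivative_eq_intros D(2,3)[OF t]
        simp: field_simps power2_eq_square power3_eq_cube)
  have E: "exp (\<gamma> t $ 1) = u t" "exp (2 * \<gamma> t $ 1) = (u t)\<^sup>2" "exp (- \<gamma> t $ 1) = inverse (u t)"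
    if "t \<in> I" for t
    using D(1,6)[OF that] by (simp_all add: exp_minus exp_double)
  have vel: "velocity \<gamma> t = v t" if "t \<in> I" for t
    using \<gamma>v[OF that] by (rule vector_derivative_at)
  have "a t $ k + (\<Sum>i\<in>UNIV. \<Sum>j\<in>UNIV. christoffel godel k i j (\<gamma> t) * v t $ i * v t $ j) = 0"
    if t: "t \<in> I" for t k
  proof -
    have u: "u t \<noteq> 0" and p: "(p t)\<^sup>2 = (1 - \<phi>\<^sup>2) * (u t)\<^sup>2 - (2 * u t - C)\<^sup>2 / 2"
      using D(1,4)[OF t] by auto
    have "\<forall>k. a t $ k + (if k = 0 then 2 * v t $ 0 * v t $ 1 + u t * v t $ 1 * v t $ 2
      else if k = 1 then u t * v t $ 0 * v t $ 2 + (u t)\<^sup>2 / 2 * (v t $ 2)\<^sup>2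
      else if k = 2 then - 2 * inverse (u t) * v t $ 0 * v t $ 1
      else 0) = 0"
      unfolding forall_4 num4_eq_0 a_def v_def
      by (simp add: p) (use u in \<open>simp add: field_simps power2_eq_square power3_eq_cube\<close>)
    then show ?thesis
      unfolding sum_christoffel_godel E[OF t] by blast
  qed
  then show "geodesic_on godel I \<gamma>"
    unfolding geodesic_on_def using \<gamma>v va by blast
  have phi: "phi0 (\<gamma> t) (v t) = 1" if t: "t \<in> I" for t
    using D(1)[OF t] by (simp add: phi0_def E[OF t] v_def field_simps power2_eq_square)
  then show "\<forall>t\<in>I. phi0 (\<gamma> t) (velocity \<gamma> t) = 1"
    by (simp add: vel)
  have "godel (\<gamma> t) (v t) (v t) = 0" if t: "t \<in> I" for t
  proof -
    have u: "u t \<noteq> 0" and p: "(p t)\<^sup>2 = (1 - \<phi>\<^sup>2) * (u t)\<^sup>2 - (2 * u t - C)\<^sup>2 / 2"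
      using D(1,4)[OF t] by auto
    show ?thesis
      unfolding godel_quadratic E[OF t]
      by (simp add: v_def power_divide p)
         (use u in \<open>simp add: field_simps power2_eq_square\<close>)
  qed
  moreover have "v t \<noteq> 0" if "t \<in> I" for t
    using phi[OF that] by (auto simp: phi0_def)
  ultimately show "isotropic_on godel I \<gamma>"
    by (simp add: isotropic_on_def vel)
qed

lemma isotropic_geodesic_imp_reduced_geodesic:
  assumes geo: "geodesic_on godel I \<gamma>" and iso: "isotropic_on godel I \<gamma>"
    and phi: "\<forall>t\<in>I. phi0 (\<gamma> t) (velocity \<gamma> t) = 1"
    and I: "is_interval I" "0 \<in> I" and "\<gamma> 0 = 0"
  obtains \<phi> C u p where "reduced_geodesic \<phi> C I u p \<gamma>"
proof -
  obtain v a where \<gamma>v: "\<And>t. t \<in> I \<Longrightarrow> (\<gamma> has_vector_derivative v t) (at t)"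
    and va: "\<And>t. t \<in> I \<Longrightarrow> (v has_vector_derivative a t) (at t)"
    and g: "\<And>t k. t \<in> I \<Longrightarrow> a t $ k
             + (\<Sum>i\<in>UNIV. \<Sum>j\<in>UNIV. christoffel godel k i j (\<gamma> t) * v t $ i * v t $ j) = 0"
    using geo unfolding geodesic_on_def by blast
  note d\<gamma> = \<gamma>v[unfolded has_vector_derivative_vec_iff, rule_format]
  note dv = va[unfolded has_vector_derivative_vec_iff, rule_format]
  define u where "u t = exp (\<gamma> t $ 1)" for t
  have u: "0 < u t" "exp (2 * \<gamma> t $ 1) = (u t)\<^sup>2" for t
    by (simp_all add: u_def exp_double)
  have vel: "velocity \<gamma> t = v t" if "t \<in> I" for t
    using \<gamma>v[OF that] by (rule vector_derivative_at)
  have v0: "v t $ 0 = 1 - u t * v t $ 2" if "t \<in> I" for t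
    using phi that by (simp add: vel phi0_def u_def algebra_simps)
  have du: "(u has_real_derivative u t * v t $ 1) (at t)" if "t \<in> I" for t
    unfolding u_def by (auto intro!: derivative_eq_intros d\<gamma> that)
  have a1: "a t $ 1 = - (u t * v t $ 0 * v t $ 2 + (u t)\<^sup>2 / 2 * (v t $ 2)\<^sup>2)" if "t \<in> I" for t
    using g[OF that, of 1] unfolding sum_christoffel_godel u u_def[symmetric] by simp
  have a2: "a t $ 2 = 2 * v t $ 0 * v t $ 1 / u t" if "t \<in> I" for t
    using g[OF that, of 2] unfolding sum_christoffel_godel
    by (simp add: u_def exp_minus field_simps)
  have a3: "a t $ 3 = 0" if "t \<in> I" for t
    using g[OF that, of 3] unfolding sum_christoffel_godel by simp
  define \<phi> where "\<phi> = v 0 $ 3"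
  have v3: "v t $ 3 = \<phi>" if "t \<in> I" for t
    unfolding \<phi>_def using dv[of _ 3] by (intro DERIV_zero_imp_eq[OF I(1) _ that I(2)]) (simp add: a3)
  have "\<gamma> t $ 3 - \<phi> * t = \<gamma> 0 $ 3 - \<phi> * 0" if "t \<in> I" for t
    using v3 by (intro DERIV_zero_imp_eq[OF I(1) _ that I(2)])
      (auto intro!: derivative_eq_intros d\<gamma>)
  then have \<gamma>3: "\<gamma> t $ 3 = \<phi> * t" if "t \<in> I" for t
    using that \<open>\<gamma> 0 = 0\<close> by simp
  \<comment> \<open>\<open>C\<close> is twice the product of the velocity with the coordinate field
    of x_2, which is conserved because the metric does not depend on x_2.\<close>
  define C where "C = (2 - u 0 * v 0 $ 2) * u 0"
  have C: "(2 - u t * v t $ 2) * u t = C" if "t \<in> I" for t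
    unfolding C_def
  proof (rule DERIV_zero_imp_eq[OF I(1) _ that I(2)])
    fix t assume t: "t \<in> I"
    show "((\<lambda>t. (2 - u t * v t $ 2) * u t) has_real_derivative 0) (at t)"
      by (rule derivative_eq_intros du[OF t] dv[OF t] refl)+
        (use u(1)[of t] in \<open>simp add: a2[OF t] v0[OF t] field_simps\<close>)
  qed
  have v2: "v t $ 2 = 2 / u t - C / (u t)\<^sup>2" if "t \<in> I" for t
    using u(1)[of t] C[OF that, symmetric] by (simp add: field_simps power2_eq_square)
  \<comment> \<open>Completing the square in the null condition produces (x_0' + u x_2')^2, which is
    1 by the normalization.\<close>
  have null: "(v t $ 1)\<^sup>2 = 1 - \<phi>\<^sup>2 - (u t * v t $ 2)\<^sup>2 / 2" if "t \<in> I" for t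
  proof -
    have "(v t $ 0)\<^sup>2 + 2 * u t * v t $ 0 * v t $ 2 + (u t)\<^sup>2 / 2 * (v t $ 2)\<^sup>2
        - (v t $ 1)\<^sup>2 - \<phi>\<^sup>2 = 0"
      using iso that v3[OF that] unfolding isotropic_on_def
      by (simp add: vel godel_quadratic u u_def[symmetric])
    then show ?thesis
      unfolding v0[OF that] by (simp add: power2_eq_square algebra_simps)
  qed
  have uv2: "u t * v t $ 2 = (2 * u t - C) / u t" if "t \<in> I" for t
    using u(1)[of t] unfolding v2[OF that] by (simp add: field_simps power2_eq_square)
  have "reduced_geodesic \<phi> C I u (\<lambda>t. u t * v t $ 1) \<gamma>"
    unfolding reduced_geodesic_def
  proof (intro ballI conjI)
    fix t assume t: "t \<in> I"
    show "((\<lambda>t. u t * v t $ 1) has_real_derivative C - (1 + \<phi>\<^sup>2) * u t) (at t)"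
    proof -
      \<comment> \<open>The null condition and the equation for x_1'' are inserted into u'' = u
        ((x_1')^2 + x_1''). The squares of u x_2' cancel and u (1 - \<phi>^2 - u x_2') remains,
        which is linear in u once \<open>C\<close> is introduced.\<close>
      have "((\<lambda>t. u t * v t $ 1) has_real_derivative u t * (v t $ 1)\<^sup>2 + u t * a t $ 1) (at t)"
        by (auto intro!: derivative_eq_intros du[OF t] dv[OF t] simp: power2_eq_square)
      moreover have "u t * (v t $ 1)\<^sup>2 + u t * a t $ 1 = C - (1 + \<phi>\<^sup>2) * u t"
        unfolding null[OF t] a1[OF t] v0[OF t] C[OF t, symmetric]
        by (simp add: power2_eq_square algebra_simps)
      ultimately show ?thesis
        by simp
    qed
    show "(u t * v t $ 1)\<^sup>2 + (2 * u t - C)\<^sup>2 / 2 = (1 - \<phi>\<^sup>2) * (u t)\<^sup>2"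
      using u(1)[of t] unfolding power_mult_distrib null[OF t] uv2[OF t]
      by (simp add: power_divide algebra_simps)
    show "((\<lambda>t. \<gamma> t $ 0) has_real_derivative C / u t - 1) (at t)"
      using d\<gamma>[OF t, of 0] u(1)[of t] unfolding v0[OF t] uv2[OF t] by (simp add: diff_divide_distrib)
    show "((\<lambda>t. \<gamma> t $ 2) has_real_derivative 2 / u t - C / (u t)\<^sup>2) (at t)"
      using d\<gamma>[OF t, of 2] unfolding v2[OF t] .
  qed (auto simp: u du \<gamma>3, simp add: u_def)
  then show ?thesis
    by (rule that)
qed

section \<open>Solution of the reduced equations\<close>

text \<open>The relative amplitude of \<open>u\<close>. The name comes from 1/u, which has the form
  of the polar equation of a conic with this eccentricity.\<close>

definition ecc :: "real \<Rightarrow> real" where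
  "ecc \<phi> = sqrt ((1 - \<phi>\<^sup>2) / 2)"

text \<open>The value about which \<open>u\<close> oscillates, determined by
  \<open>u 0 = 1\<close>.\<close>

definition orbit_scale :: "real \<Rightarrow> real \<Rightarrow> real" where
  "orbit_scale \<phi> t0 = 1 / (1 + ecc \<phi> * cos (omega \<phi> * t0))"

lemma ecc_squared: "\<bar>\<phi>\<bar> \<le> 1 \<Longrightarrow> (ecc \<phi>)\<^sup>2 = (1 - \<phi>\<^sup>2) / 2"
  by (simp add: ecc_def abs_square_le_1)

lemma ecc_pos: "\<bar>\<phi>\<bar> < 1 \<Longrightarrow> 0 < ecc \<phi>"
  by (simp add: ecc_def abs_square_less_1)

lemma ecc_less_1: "ecc \<phi> < 1"
proof -
  have "1 - \<phi>\<^sup>2 < 2"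
    using zero_le_power2[of \<phi>] by linarith
  then show ?thesis
    by (simp add: ecc_def)
qed

lemma omega_squared: "(omega \<phi>)\<^sup>2 = 1 + \<phi>\<^sup>2"
  by (simp add: omega_def add_nonneg_nonneg)

lemma omega_pos: "0 < omega \<phi>"
  by (simp add: omega_def add_nonneg_pos)

lemma one_plus_ecc_cos_pos:
  assumes "\<bar>\<phi>\<bar> < 1"
  shows "0 < 1 + ecc \<phi> * cos \<tau>"
proof -
  have "\<bar>ecc \<phi> * cos \<tau>\<bar> \<le> ecc \<phi> * 1"
    using ecc_pos[OF assms] unfolding abs_mult by (intro mult_mono) auto
  then show ?thesis
    using ecc_less_1[of \<phi>] by linarith
qed

lemma orbit_scale_pos: "\<bar>\<phi>\<bar> < 1 \<Longrightarrow> 0 < orbit_scale \<phi> t0"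
  by (simp add: orbit_scale_def one_plus_ecc_cos_pos)

lemma alpha_pos:
  assumes "\<bar>\<phi>\<bar> < 1"
  shows "0 < alpha \<phi>"
proof -
  have "sqrt (1 - \<phi>\<^sup>2) < sqrt 2"
    using zero_le_power2[of \<phi>] by (intro real_sqrt_less_mono) linarith
  moreover have "0 \<le> sqrt (1 - \<phi>\<^sup>2)"
    using assms by (simp add: abs_square_le_1)
  ultimately show ?thesis
    by (simp add: alpha_def add_pos_nonneg)
qed

lemma alpha_eq_ecc:
  assumes "\<bar>\<phi>\<bar> < 1"
  shows "alpha \<phi> = (1 - ecc \<phi>) / (1 + ecc \<phi>)"
proof -
  have "sqrt (1 - \<phi>\<^sup>2) = sqrt 2 * ecc \<phi>"
    by (simp add: ecc_def real_sqrt_divide)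
  then have "alpha \<phi> = (sqrt 2 * (1 - ecc \<phi>)) / (sqrt 2 * (1 + ecc \<phi>))"
    by (simp add: alpha_def algebra_simps)
  then show ?thesis
    by simp
qed

text \<open>The denominators of the stated formulas are thereby constant multiples of
  \<open>u\<close>.\<close>

lemma denom_eq_ecc:
  assumes "\<bar>\<phi>\<bar> < 1"
  shows "denom \<phi> \<tau> = (1 + alpha \<phi>) * (1 + ecc \<phi> * cos \<tau>)"
proof -
  have "1 - alpha \<phi> = (1 + alpha \<phi>) * ecc \<phi>"
    using ecc_pos[OF assms] by (simp add: alpha_eq_ecc[OF assms] divide_simps)
  then show ?thesis
    unfolding denom_def by (simp only: distrib_left mult_1_right mult.assoc)
qed

text \<open>This makes the coefficient of the arctangent fit x_0'. After squaring, \<alpha> = (1 -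
  \<epsilon>)/(1 + \<epsilon>) and \<omega>^2 = 2 (1 - \<epsilon>^2) turn both sides into 8
  \<alpha>.\<close>

lemma sqrt_alpha_eq:
  assumes "\<bar>\<phi>\<bar> < 1"
  shows "2 * sqrt 2 * sqrt (alpha \<phi>) = omega \<phi> * (1 + alpha \<phi>)"
proof (rule power2_eq_imp_eq)
  have e: "1 + ecc \<phi> \<noteq> 0" and \<phi>: "\<phi>\<^sup>2 = 1 - 2 * (ecc \<phi>)\<^sup>2"
    using ecc_pos[OF assms] ecc_squared[of \<phi>] assms by auto
  have "(2 * sqrt 2 * sqrt (alpha \<phi>))\<^sup>2 = 8 * alpha \<phi>"
    using alpha_pos[OF assms] by (simp add: power_mult_distrib)
  also have "\<dots> = (1 + \<phi>\<^sup>2) * (1 + alpha \<phi>)\<^sup>2"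
    unfolding alpha_eq_ecc[OF assms] \<phi> using e
    by (simp add: divide_simps) (simp add: power2_eq_square algebra_simps)
  also have "\<dots> = (omega \<phi> * (1 + alpha \<phi>))\<^sup>2"
    by (simp add: power_mult_distrib omega_squared)
  finally show "(2 * sqrt 2 * sqrt (alpha \<phi>))\<^sup>2 = (omega \<phi> * (1 + alpha \<phi>))\<^sup>2" .
qed (use alpha_pos[OF assms] omega_pos[of \<phi>] in auto)

lemma beta_eq_orbit_scale:
  assumes "\<bar>\<phi>\<bar> < 1"
  shows "beta \<phi> t0 = 2 * ecc \<phi> * (1 + alpha \<phi>) / (omega \<phi> * orbit_scale \<phi> t0)"
proof -
  have "sqrt (2 * (1 - \<phi>\<^sup>2)) = sqrt (2\<^sup>2 * ((1 - \<phi>\<^sup>2) / 2))"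
    by simp
  also have "\<dots> = 2 * ecc \<phi>"
    unfolding real_sqrt_mult ecc_def by simp
  finally show ?thesis
    by (simp add: beta_def denom_eq_ecc[OF assms] orbit_scale_def omega_def mult.assoc)
qed

section \<open>Explicit solutions, and why there are no others\<close>

lemma curve_ii_exists: "\<exists>c. curve_ii \<phi> t0 c"
proof -
  have "\<exists>c :: real \<Rightarrow> real ^ 4. \<forall>t. c t $ 0 = f t \<and> c t $ 1 = g t \<and> c t $ 2 = h t \<and> c t $ 3 = k t"
    for f g h k :: "real \<Rightarrow> real"
    by (rule exI[of _ "\<lambda>t. \<chi> i::4. if i = 0 then f t else if i = 1 then g t
        else if i = 2 then h t else k t"]) simp
  then show ?thesis
    unfolding curve_ii_def .
qed

lemma curve_i_zero: "curve_i \<sigma> c \<Longrightarrow> c 0 = 0"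
  unfolding vec_eq_iff forall_4 num4_eq_0 by (simp add: curve_i_def)

lemma curve_ii_zero: "curve_ii \<phi> t0 c \<Longrightarrow> c 0 = 0"
  unfolding vec_eq_iff forall_4 num4_eq_0 by (simp add: curve_ii_def)

lemma reduced_geodesic_curve_i:
  assumes "curve_i \<sigma> c" and "\<sigma>\<^sup>2 = 1"
  shows "reduced_geodesic \<sigma> 2 UNIV (\<lambda>_. 1) (\<lambda>_. 0) c"
  using assms by (simp add: reduced_geodesic_def curve_i_def DERIV_ident)

text \<open>The constant is chosen so that the equilibrium C/\<omega>^2 of the oscillator is the
  centre \<open>orbit_scale\<close> of the oscillation. The other clauses follow by differentiating
  the closed formulas.\<close>

lemma reduced_geodesic_curve_ii:
  assumes c: "curve_ii \<phi> t0 c" and \<phi>: "\<bar>\<phi>\<bar> < 1"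
  shows "reduced_geodesic \<phi> ((omega \<phi>)\<^sup>2 * orbit_scale \<phi> t0) UNIV
    (\<lambda>t. orbit_scale \<phi> t0 * (1 + ecc \<phi> * cos (omega \<phi> * (t - t0))))
    (\<lambda>t. - orbit_scale \<phi> t0 * ecc \<phi> * omega \<phi> * sin (omega \<phi> * (t - t0))) c"
  unfolding reduced_geodesic_def
proof (intro ballI conjI)
  define \<alpha> e \<omega> D where "\<alpha> = alpha \<phi>" and "e = ecc \<phi>" and "\<omega> = omega \<phi>" and "D = orbit_scale \<phi> t0"
  note defs = \<alpha>_def[symmetric] e_def[symmetric] \<omega>_def[symmetric] D_def[symmetric]
  have e: "e\<^sup>2 = (1 - \<phi>\<^sup>2) / 2" and \<omega>: "0 < \<omega>" "\<omega>\<^sup>2 = 1 + \<phi>\<^sup>2" and \<alpha>: "0 < \<alpha>" and D: "0 < D"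
    and pos: "\<And>\<tau>. 0 < 1 + e * cos \<tau>"
    using ecc_squared[of \<phi>] omega_pos omega_squared alpha_pos orbit_scale_pos one_plus_ecc_cos_pos \<phi>
    by (simp_all add: e_def \<omega>_def \<alpha>_def D_def)
  note eqs = denom_eq_ecc[OF \<phi>] beta_eq_orbit_scale[OF \<phi>]
  fix t :: real
  define \<tau> where "\<tau> = \<omega> * (t - t0)"
  have cs: "(sin \<tau>)\<^sup>2 = 1 - (cos \<tau>)\<^sup>2"
    by (simp add: sin_squared_eq)
  have \<phi>2: "\<phi>\<^sup>2 = 1 - 2 * e\<^sup>2" and \<omega>2: "\<omega>\<^sup>2 = 2 - 2 * e\<^sup>2"
    using e \<omega> by auto
  show "0 < orbit_scale \<phi> t0 * (1 + ecc \<phi> * cos (omega \<phi> * (t - t0)))"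
    unfolding defs using D pos by simp
  show "((\<lambda>t. orbit_scale \<phi> t0 * (1 + ecc \<phi> * cos (omega \<phi> * (t - t0)))) has_real_derivative
      - orbit_scale \<phi> t0 * ecc \<phi> * omega \<phi> * sin (omega \<phi> * (t - t0))) (at t)"
    by (auto intro!: derivative_eq_intros)
  have "((\<lambda>t. - D * e * \<omega> * sin (\<omega> * (t - t0))) has_real_derivative
      - D * e * \<omega>\<^sup>2 * cos (\<omega> * (t - t0))) (at t)"
    by (auto intro!: derivative_eq_intros simp: power2_eq_square)
  then show "((\<lambda>t. - orbit_scale \<phi> t0 * ecc \<phi> * omega \<phi> * sin (omega \<phi> * (t - t0)))
      has_real_derivative (omega \<phi>)\<^sup>2 * orbit_scale \<phi> t0 - (1 + \<phi>\<^sup>2) *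
        (orbit_scale \<phi> t0 * (1 + ecc \<phi> * cos (omega \<phi> * (t - t0))))) (at t)"
    unfolding defs \<omega>(2) by (simp add: algebra_simps)
  have "(- D * e * \<omega> * sin \<tau>)\<^sup>2 = D\<^sup>2 * e\<^sup>2 * (2 - 2 * e\<^sup>2) * (1 - (cos \<tau>)\<^sup>2)"
    by (simp add: power_mult_distrib \<omega>2 cs)
  then show "(- orbit_scale \<phi> t0 * ecc \<phi> * omega \<phi> * sin (omega \<phi> * (t - t0)))\<^sup>2 +
      (2 * (orbit_scale \<phi> t0 * (1 + ecc \<phi> * cos (omega \<phi> * (t - t0)))) - (omega \<phi>)\<^sup>2 * orbit_scale \<phi> t0)\<^sup>2 / 2
      = (1 - \<phi>\<^sup>2) * (orbit_scale \<phi> t0 * (1 + ecc \<phi> * cos (omega \<phi> * (t - t0))))\<^sup>2"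
    unfolding defs \<tau>_def[symmetric] \<phi>2 \<omega>2 by (simp add: power2_eq_square field_simps)
  show "((\<lambda>t. c t $ 0) has_real_derivative
      (omega \<phi>)\<^sup>2 * orbit_scale \<phi> t0 / (orbit_scale \<phi> t0 * (1 + ecc \<phi> * cos (omega \<phi> * (t - t0)))) - 1) (at t)"
  proof -
    define r where "r = sqrt \<alpha>"
    define q where "q = (cos (\<tau> / 2))\<^sup>2 + r\<^sup>2 * (sin (\<tau> / 2))\<^sup>2"
    have r: "0 < r" "r\<^sup>2 = \<alpha>"
      using \<alpha> by (simp_all add: r_def)
    have "((\<lambda>t. - t + 2 * sqrt 2 * arctan_tan r (\<omega> * (t - t0) / 2) -
          2 * sqrt 2 * arctan_tan r (- \<omega> * t0 / 2))
        has_real_derivative - 1 + 2 * sqrt 2 * (r / q * (\<omega> / 2))) (at t)"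
      unfolding q_def \<tau>_def using r(1)
      by (auto intro!: derivative_eq_intros DERIV_chain2[OF has_real_derivative_arctan_tan])
    \<comment> \<open>The half-angle formulas turn the denominator from the derivative of
      \<open>arctan_tan\<close> into \<open>denom\<close>.\<close>
    moreover have "2 * q = (1 + \<alpha>) * (1 + e * cos \<tau>)"
    proof -
      have half: "2 * (cos (\<tau> / 2))\<^sup>2 = 1 + cos \<tau>" "2 * (sin (\<tau> / 2))\<^sup>2 = 1 - cos \<tau>"
        using cos_double_cos[of "\<tau> / 2"] cos_double_sin[of "\<tau> / 2"] by simp_all
      have "2 * q = 2 * (cos (\<tau> / 2))\<^sup>2 + \<alpha> * (2 * (sin (\<tau> / 2))\<^sup>2)"
        by (simp add: q_def r)
      also have "\<dots> = denom \<phi> \<tau>"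
        unfolding half denom_def defs by (simp add: algebra_simps)
      finally have "2 * q = denom \<phi> \<tau>" .
      then show ?thesis
        by (simp add: eqs defs)
    qed
    moreover have "2 * sqrt 2 * r = \<omega> * (1 + \<alpha>)"
      using sqrt_alpha_eq[OF \<phi>] by (simp add: r_def \<alpha>_def \<omega>_def)
    moreover have "2 * sqrt 2 * (r / q * (\<omega> / 2)) = 2 * sqrt 2 * r * \<omega> / (2 * q)"
      by simp
    ultimately have "((\<lambda>t. c t $ 0) has_real_derivative
        - 1 + \<omega> * (1 + \<alpha>) * \<omega> / ((1 + \<alpha>) * (1 + e * cos \<tau>))) (at t)"
      using c by (simp add: curve_ii_def r_def \<alpha>_def \<omega>_def)
    moreover have "- 1 + \<omega> * (1 + \<alpha>) * \<omega> / ((1 + \<alpha>) * (1 + e * cos \<tau>))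
        = \<omega>\<^sup>2 * D / (D * (1 + e * cos \<tau>)) - 1"
      using \<alpha> D by (simp add: power2_eq_square)
    ultimately show ?thesis
      unfolding defs \<tau>_def by simp
  qed
  show "c t $ 1 = ln (orbit_scale \<phi> t0 * (1 + ecc \<phi> * cos (omega \<phi> * (t - t0))))"
  proof -
    have D': "D = 1 / (1 + e * cos (\<omega> * t0))"
      by (simp add: D_def orbit_scale_def e_def \<omega>_def)
    show ?thesis
      using c \<alpha> pos[of "\<omega> * t0"] pos[of "\<omega> * (t - t0)"]
      by (simp add: curve_ii_def eqs defs) (simp add: D' ln_mult ln_div)
  qed
  show "((\<lambda>t. c t $ 2) has_real_derivative
      2 / (orbit_scale \<phi> t0 * (1 + ecc \<phi> * cos (omega \<phi> * (t - t0)))) -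
      (omega \<phi>)\<^sup>2 * orbit_scale \<phi> t0 / (orbit_scale \<phi> t0 * (1 + ecc \<phi> * cos (omega \<phi> * (t - t0))))\<^sup>2) (at t)"
  proof -
    \<comment> \<open>\<open>B\<close> is \<open>beta\<close> after cancelling the factor 1 +
      \<alpha> that it shares with \<open>denom\<close>.\<close>
    define B where "B = 2 * e / (\<omega> * D)"
    have B: "beta \<phi> t0 * x / denom \<phi> y = B * x / (1 + e * cos y)" for x y
      using \<alpha> by (simp add: eqs defs B_def)
    have c2: "(\<lambda>t. c t $ 2) = (\<lambda>t. B * sin (\<omega> * (t - t0)) / (1 + e * cos (\<omega> * (t - t0))) -
        B * sin (- \<omega> * t0) / (1 + e * cos (- \<omega> * t0)))"
      using c unfolding curve_ii_def B defs by (simp add: fun_eq_iff)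
    have "((\<lambda>t. c t $ 2) has_real_derivative
        (B * (cos \<tau> * \<omega>) * (1 + e * cos \<tau>) - B * sin \<tau> * (- e * sin \<tau> * \<omega>))
          / (1 + e * cos \<tau>)\<^sup>2) (at t)"
      unfolding c2 \<tau>_def using pos[of "\<omega> * (t - t0)"]
      by (auto intro!: derivative_eq_intros simp: power2_eq_square)
    moreover have "(B * (cos \<tau> * \<omega>) * (1 + e * cos \<tau>) - B * sin \<tau> * (- e * sin \<tau> * \<omega>))
        = B * \<omega> * (cos \<tau> + e)"
    proof -
      have "(B * (cos \<tau> * \<omega>) * (1 + e * cos \<tau>) - B * sin \<tau> * (- e * sin \<tau> * \<omega>))
        = B * \<omega> * (cos \<tau> + e * ((sin \<tau>)\<^sup>2 + (cos \<tau>)\<^sup>2))"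
        by (simp add: power2_eq_square algebra_simps del: sin_cos_squared_add sin_cos_squared_add3)
      then show ?thesis
        by simp
    qed
    \<comment> \<open>Rests on 2 (1 + e cos \<tau>) - \<omega>^2 = 2 e (cos \<tau> + e), since
      \<omega>^2 = 2 - 2 e^2.\<close>
    moreover have "B * \<omega> * (cos \<tau> + e) / (1 + e * cos \<tau>)\<^sup>2
        = 2 / (D * (1 + e * cos \<tau>)) - \<omega>\<^sup>2 * D / (D * (1 + e * cos \<tau>))\<^sup>2"
      unfolding B_def \<omega>2 using \<omega>(1) D pos[of \<tau>, THEN less_imp_neq]
      by (simp add: power_mult_distrib divide_simps) (simp add: power2_eq_square algebra_simps)
    ultimately show ?thesis
      unfolding defs \<tau>_def by simp
  qed
  show "c t $ 3 = \<phi> * t"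
    using c by (simp add: curve_ii_def)
qed

text \<open>The oscillator leaves an amplitude and a phase free. The null condition fixes the
  amplitude relative to the centre, the phase becomes \<open>t0\<close>, and \<open>u 0 = 1\<close>
  fixes the centre.\<close>

lemma reduced_geodesic_solution:
  assumes r: "reduced_geodesic \<phi> C I u p \<gamma>" and I: "is_interval I" "0 \<in> I"
    and u0: "u 0 = 1" and \<phi>: "\<bar>\<phi>\<bar> < 1"
  obtains t0 where "C = (omega \<phi>)\<^sup>2 * orbit_scale \<phi> t0"
    and "\<And>t. t \<in> I \<Longrightarrow> u t = orbit_scale \<phi> t0 * (1 + ecc \<phi> * cos (omega \<phi> * (t - t0)))"
proof -
  note D = reduced_geodesicD[OF r]
  define e \<omega> where "e = ecc \<phi>" and "\<omega> = omega \<phi>"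
  have e: "e\<^sup>2 = (1 - \<phi>\<^sup>2) / 2" "0 < e" and \<omega>: "0 < \<omega>" "\<omega>\<^sup>2 = 1 + \<phi>\<^sup>2"
    using ecc_squared[of \<phi>] ecc_pos omega_pos omega_squared \<phi> by (simp_all add: e_def \<omega>_def)
  \<comment> \<open>Otherwise (2 - C)^2 / 2 is at least 2, while the null condition at time 0 bounds
    it by 1 - \<phi>^2. Positivity makes \<open>R\<close> below a genuine amplitude.\<close>
  have "0 < C"
  proof (rule ccontr)
    assume "\<not> 0 < C"
    then have "2\<^sup>2 \<le> (2 - C)\<^sup>2"
      by (intro power_mono) auto
    then show False
      using D(4)[OF I(2)] zero_le_power2[of \<phi>] zero_le_power2[of "p 0"] unfolding u0 by simp
  qed
  \<comment> \<open>The deviation from the equilibrium satisfies the homogeneous equation h'' = -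
    \<omega>^2 h.\<close>
  define h where "h t = u t - C / \<omega>\<^sup>2" for t
  have dh: "(h has_real_derivative p t) (at t)" if "t \<in> I" for t
    unfolding h_def by (auto intro!: derivative_eq_intros D(2) that)
  have dp: "(p has_real_derivative - \<omega>\<^sup>2 * h t) (at t)" if "t \<in> I" for t
    using D(3)[OF that] \<omega>(1) unfolding h_def \<omega>(2)[symmetric] by (simp add: right_diff_distrib)
  \<comment> \<open>\<open>(\<omega> h, p)\<close> rotates with angular velocity \<open>\<omega>\<close>; \<open>A\<close> and \<open>B\<close> are its coordinates in the co-rotating frame.\<close>
  have A: "\<omega> * h t * cos (\<omega> * t) - p t * sin (\<omega> * t) =
      \<omega> * h 0 * cos (\<omega> * 0) - p 0 * sin (\<omega> * 0)"
    if "t \<in> I" for t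
    by (intro DERIV_zero_imp_eq[OF I(1) _ that I(2)])
      (auto intro!: derivative_eq_intros dh dp simp: power2_eq_square algebra_simps)
  have B: "\<omega> * h t * sin (\<omega> * t) + p t * cos (\<omega> * t) =
      \<omega> * h 0 * sin (\<omega> * 0) + p 0 * cos (\<omega> * 0)"
    if "t \<in> I" for t
    by (intro DERIV_zero_imp_eq[OF I(1) _ that I(2)])
      (auto intro!: derivative_eq_intros dh dp simp: power2_eq_square algebra_simps)
  have h: "h t = h 0 * cos (\<omega> * t) + p 0 / \<omega> * sin (\<omega> * t)" if "t \<in> I" for t
  proof -
    have "\<omega> * h t = \<omega> * h t * ((sin (\<omega> * t))\<^sup>2 + (cos (\<omega> * t))\<^sup>2)"
      by simp
    also have "\<dots> = (\<omega> * h t * cos (\<omega> * t) - p t * sin (\<omega> * t)) * cos (\<omega> * t)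
        + (\<omega> * h t * sin (\<omega> * t) + p t * cos (\<omega> * t)) * sin (\<omega> * t)"
      unfolding power2_eq_square by (simp only: algebra_simps)
    also have "\<dots> = \<omega> * h 0 * cos (\<omega> * t) + p 0 * sin (\<omega> * t)"
      unfolding A[OF that] B[OF that] by simp
    finally show ?thesis
      using \<omega>(1) by (simp add: field_simps)
  qed
  define R where "R = C / \<omega>\<^sup>2 * e"
  have R: "0 < R"
    unfolding R_def using \<open>0 < C\<close> \<omega>(1) e(2)
    by (intro mult_pos_pos divide_pos_pos zero_less_power)
  \<comment> \<open>The null condition at time 0 puts the initial data on the circle of radius
    \<open>R\<close>; their polar angle is the phase.\<close>
  have "(h 0)\<^sup>2 + (p 0 / \<omega>)\<^sup>2 = R\<^sup>2"
  proof -
    have W: "\<omega>\<^sup>2 = 2 - 2 * e\<^sup>2" and \<phi>2: "\<phi>\<^sup>2 = 1 - 2 * e\<^sup>2"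
      using e \<omega> by auto
    have P: "(p 0)\<^sup>2 = (1 - \<phi>\<^sup>2) - (2 - C)\<^sup>2 / 2"
      using D(4)[OF I(2)] by (simp add: u0)
    have "(h 0)\<^sup>2 + (p 0 / \<omega>)\<^sup>2 = ((\<omega>\<^sup>2 - C)\<^sup>2 + (p 0)\<^sup>2 * \<omega>\<^sup>2) / (\<omega>\<^sup>2)\<^sup>2"
      using \<omega>(1) unfolding h_def u0 by (simp add: divide_simps power2_eq_square)
    also have "(\<omega>\<^sup>2 - C)\<^sup>2 + (p 0)\<^sup>2 * \<omega>\<^sup>2 = C\<^sup>2 * e\<^sup>2"
      unfolding P \<phi>2 W by (simp add: power2_eq_square field_simps)
    finally show ?thesis
      by (simp add: R_def power_divide power_mult_distrib)
  qed
  then have "(h 0 / R)\<^sup>2 + (p 0 / \<omega> / R)\<^sup>2 = 1"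
    using R unfolding power_divide[of _ R] add_divide_distrib[symmetric] by simp
  then obtain \<theta> where \<theta>: "h 0 / R = cos \<theta>" "p 0 / \<omega> / R = sin \<theta>"
    using sincos_total_2pi by metis
  define t0 where "t0 = \<theta> / \<omega>"
  have \<theta>': "h 0 = R * cos (\<omega> * t0)" "p 0 / \<omega> = R * sin (\<omega> * t0)"
    using \<theta> R \<omega>(1) by (simp_all add: t0_def field_simps)
  have u: "u t = C / \<omega>\<^sup>2 * (1 + e * cos (\<omega> * (t - t0)))" if "t \<in> I" for t
  proof -
    have "u t = C / \<omega>\<^sup>2 + h t"
      by (simp add: h_def)
    also have "\<dots> = C / \<omega>\<^sup>2 + R * cos (\<omega> * (t - t0))"
      unfolding h[OF that] \<theta>' by (simp add: right_diff_distrib cos_diff algebra_simps)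
    finally show ?thesis
      by (simp add: R_def algebra_simps)
  qed
  have "C / \<omega>\<^sup>2 = orbit_scale \<phi> t0"
  proof -
    have "C / \<omega>\<^sup>2 * (1 + e * cos (\<omega> * t0)) = 1"
      using u[OF I(2)] by (simp only: u0 diff_0 mult_minus_right cos_minus)
    moreover have "1 + e * cos (\<omega> * t0) \<noteq> 0"
      using one_plus_ecc_cos_pos[OF \<phi>, of "\<omega> * t0"] by (simp add: e_def)
    ultimately show ?thesis
      unfolding orbit_scale_def e_def[symmetric] \<omega>_def[symmetric] by (intro eq_divide_imp)
  qed
  then show ?thesis
    using that[of t0] u \<omega>(1) by (simp add: e_def \<omega>_def field_simps)
qed

theorem theorem4:
  fixes \<gamma> :: "real \<Rightarrow> real ^ 4" and I :: "real set"
  assumes "open I" and "is_interval I" and "0 \<in> I"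
  shows "(geodesic_on godel I \<gamma> \<and> isotropic_on godel I \<gamma> \<and> \<gamma> 0 = 0 \<and> \<not> \<gamma> ` I \<subseteq> G0 \<and>
            (\<forall>t\<in>I. phi0 (\<gamma> t) (velocity \<gamma> t) = 1))
         \<longleftrightarrow>
         (\<exists>c. (\<forall>t\<in>I. \<gamma> t = c t) \<and>
            ((curve_i 1 c \<or> curve_i (- 1) c) \<or>
             (\<exists>\<phi>3 t0. 0 < \<bar>\<phi>3\<bar> \<and> \<bar>\<phi>3\<bar> < 1 \<and> curve_ii \<phi>3 t0 c)))"
  (is "?geo \<longleftrightarrow> ?curve")
proof
  assume ?curve
  then obtain c where c: "\<And>t. t \<in> I \<Longrightarrow> \<gamma> t = c t"
    and form: "curve_i 1 c \<or> curve_i (- 1) c \<or>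
      (\<exists>\<phi>3 t0. 0 < \<bar>\<phi>3\<bar> \<and> \<bar>\<phi>3\<bar> < 1 \<and> curve_ii \<phi>3 t0 c)"
    by blast
  have "\<exists>\<phi> C u p. \<phi> \<noteq> 0 \<and> reduced_geodesic \<phi> C UNIV u p c \<and> c 0 = 0"
    using form
  proof (elim disjE exE conjE)
    assume c: "curve_i 1 c"
    have "reduced_geodesic 1 2 UNIV (\<lambda>_. 1) (\<lambda>_. 0) c"
      using c by (rule reduced_geodesic_curve_i) simp
    then show ?thesis
      using curve_i_zero[OF c] one_neq_zero by blast
  next
    assume c: "curve_i (- 1) c"
    have "reduced_geodesic (- 1) 2 UNIV (\<lambda>_. 1) (\<lambda>_. 0) c"
      using c by (rule reduced_geodesic_curve_i) simp
    moreover have "- 1 \<noteq> (0 :: real)"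
      by simp
    ultimately show ?thesis
      using curve_i_zero[OF c] by blast
  next
    fix \<phi>3 t0
    assume "0 < \<bar>\<phi>3\<bar>" "\<bar>\<phi>3\<bar> < 1" "curve_ii \<phi>3 t0 c"
    then show ?thesis
      using reduced_geodesic_curve_ii curve_ii_zero by fastforce
  qed
  then obtain \<phi> C u p where "\<phi> \<noteq> 0" and r: "reduced_geodesic \<phi> C UNIV u p c" and "c 0 = 0"
    by blast
  have r: "reduced_geodesic \<phi> C I u p \<gamma>"
    using reduced_geodesic_cong[OF r \<open>open I\<close> c] .
  \<comment> \<open>Leaving \<open>G0\<close> needs a nonzero time in \<open>I\<close>, because x_3
    = \<phi> t vanishes at 0; d/2 is such a time.\<close>
  obtain d where d: "0 < d" "ball 0 d \<subseteq> I"
    using \<open>open I\<close> \<open>0 \<in> I\<close> by (auto simp: open_contains_ball)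
  then have "d / 2 \<in> I"
    by (intro subsetD[OF d(2)]) auto
  then have "\<not> \<gamma> ` I \<subseteq> G0"
    using reduced_geodesicD(8)[OF r, of "d / 2"] \<open>\<phi> \<noteq> 0\<close> d(1) by (auto simp: G0_def)
  then show ?geo
    using reduced_geodesic_imp_isotropic_geodesic[OF r \<open>open I\<close>] c \<open>c 0 = 0\<close> \<open>0 \<in> I\<close> by simp
next
  assume geo: ?geo
  then obtain \<phi> C u p where r: "reduced_geodesic \<phi> C I u p \<gamma>"
    using isotropic_geodesic_imp_reduced_geodesic assms(2,3) by metis
  note D = reduced_geodesicD[OF r]
  have \<gamma>0: "\<gamma> 0 = 0"
    using geo by blast
  have u0: "u 0 = 1"
    using D(1,6)[OF \<open>0 \<in> I\<close>] \<gamma>0 by simp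
  have "\<phi> \<noteq> 0"
    using geo D(8) by (auto simp: G0_def)
  have E: "(p 0)\<^sup>2 + (2 - C)\<^sup>2 / 2 = 1 - \<phi>\<^sup>2"
    using D(4)[OF \<open>0 \<in> I\<close>] by (simp add: u0)
  have "\<phi>\<^sup>2 \<le> 1"
    using E zero_le_power2[of "p 0"] zero_le_power2[of "2 - C"] by linarith
  then have "\<bar>\<phi>\<bar> \<le> 1"
    by (simp add: abs_square_le_1)
  then have "(\<phi> = 1 \<or> \<phi> = - 1) \<or> \<bar>\<phi>\<bar> < 1"
    by linarith
  then consider "\<phi> = 1 \<or> \<phi> = - 1" | "\<bar>\<phi>\<bar> < 1"
    by blast
  then show ?curve
  proof cases
    case 1
    then have \<phi>2: "\<phi>\<^sup>2 = 1"
      by auto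
    \<comment> \<open>For \<open>\<phi>\<^sup>2 = 1\<close> the null condition is a vanishing sum of
      squares: at time 0 it forces C = 2, and then u = 1 at every time. Both signs of \<phi> occur,
      one light ray for each.\<close>
    then have "C = 2"
      using E by (simp add: add_nonneg_eq_0_iff)
    have u: "u t = 1" if "t \<in> I" for t
      using D(4)[OF that] unfolding \<phi>2 \<open>C = 2\<close> by (simp add: add_nonneg_eq_0_iff)
    define c :: "real \<Rightarrow> real ^ 4" where
      "c t = (\<chi> k. if k = 0 then t else if k = 3 then \<phi> * t else 0)" for t
    have c: "curve_i \<phi> c"
      by (simp add: curve_i_def c_def)
    have rc: "reduced_geodesic \<phi> C I (\<lambda>_. 1) (\<lambda>_. 0) c"
      using reduced_geodesic_cong[OF reduced_geodesic_curve_i[OF c \<phi>2] \<open>open I\<close>] \<open>C = 2\<close> by simp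
    have "c 0 = 0"
      by (simp add: c_def vec_eq_iff)
    have "\<gamma> t = c t" if "t \<in> I" for t
      using reduced_geodesic_unique[OF r rc _ assms(2,3) _ that] u \<gamma>0 \<open>c 0 = 0\<close> by simp
    then show ?thesis
      using c 1 by blast
  next
    case 2
    obtain t0 where C: "C = (omega \<phi>)\<^sup>2 * orbit_scale \<phi> t0"
      and u: "\<And>t. t \<in> I \<Longrightarrow> u t = orbit_scale \<phi> t0 * (1 + ecc \<phi> * cos (omega \<phi> * (t - t0)))"
      using reduced_geodesic_solution[OF r assms(2,3) u0 2] by blast
    obtain c where c: "curve_ii \<phi> t0 c"
      using curve_ii_exists by blast
    \<comment> \<open>With \<open>refl\<close> the congruence only restricts the explicit solution
      from the whole line to \<open>I\<close>.\<close>
    note rc = reduced_geodesic_cong[OF reduced_geodesic_curve_ii[OF c 2, folded C] \<open>open I\<close> refl]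
    have "\<gamma> t = c t" if "t \<in> I" for t
      using reduced_geodesic_unique[OF r rc u assms(2,3) _ that] curve_ii_zero[OF c] \<gamma>0 by simp
    then show ?thesis
      using c 2 \<open>\<phi> \<noteq> 0\<close> by (metis zero_less_abs_iff)
  qed
qed

end
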